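(* Let $\Gamma$ be a set and let $(e_\gamma)_{\gamma\in\Gamma}$ be the canonical basis of $\ell_1(\Gamma)$. Then every dense linear subspace of $\ell_1(\Gamma)$ contains a dense linear subspace that is linearly isomorphic to $\mathrm{span}\{e_\gamma\}_{\gamma\in\Gamma}$. In particular, any two dense linear subspaces of $\ell_1(\Gamma)$ are densely isomorphic.
   Context: "Subspace" means linear subspace, not necessarily closed; $\mathrm{span}$ denotes the (algebraic) linear span. Normed spaces are linearly isomorphic if there is a linear bijection between them that is bounded with bounded inverse. Two normed spaces $Y$ and $Z$ are densely isomorphic if there exist dense linear subspaces $Y_0$ of $Y$ and $Z_0$ of $Z$ that are linearly isomorphic. *)

theory Defs
  imports "HOL-Analysis.Analysis"
begin

section \<open>The spaces \<open>\<ell>\<^sub>1(\<Gamma>)\<close>\<close>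

text \<open>
  The scalar field is a type variable \<open>'k\<close> of class \<^class>\<open>real_normed_field\<close>; by the
  Gelfand--Mazur theorem, up to isometric isomorphism it is \<open>\<real>\<close> or \<open>\<complex>\<close>. The type
  \<open>('g, 'k) ell1\<close> is the space of absolutely summable families indexed by the whole type \<open>'g\<close>;
  \<open>\<ell>\<^sub>1(\<Gamma>)\<close> for an arbitrary (possibly empty) \<open>\<Gamma> :: 'g set\<close> is the subspace \<open>ell1_on \<Gamma>\<close> below of
  families vanishing off \<open>\<Gamma>\<close>.
\<close>

typedef (overloaded) ('g, 'k::real_normed_field) ell1 =
  "{x :: 'g \<Rightarrow> 'k. (\<lambda>g. norm (x g)) summable_on UNIV}"
  morphisms ell1_coord Abs_ell1
  by (rule exI[of _ "\<lambda>_. 0"]) simp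

setup_lifting type_definition_ell1

lemma ell1_eqI: "(\<And>g. ell1_coord x g = ell1_coord y g) \<Longrightarrow> x = y"
  by transfer auto

lemma ell1_abs_summable: "(\<lambda>g. norm (ell1_coord x g)) summable_on UNIV"
  using ell1_coord[of x] by simp

lemma abs_summable_on_plus:
  fixes x y :: "'g \<Rightarrow> 'k::real_normed_vector"
  assumes "(\<lambda>g. norm (x g)) summable_on A" "(\<lambda>g. norm (y g)) summable_on A"
  shows "(\<lambda>g. norm (x g + y g)) summable_on A"
  by (rule summable_on_comparison_test[OF summable_on_add[OF assms]])
     (auto intro: norm_triangle_ineq)

instantiation ell1 :: (type, real_normed_field) real_normed_vector
begin

lift_definition zero_ell1 :: "('a, 'b) ell1" is "\<lambda>_. 0"
  by simp

lift_definition plus_ell1 :: "('a, 'b) ell1 \<Rightarrow> ('a, 'b) ell1 \<Rightarrow> ('a, 'b) ell1"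
  is "\<lambda>x y g. x g + y g"
  by (rule abs_summable_on_plus)

lift_definition uminus_ell1 :: "('a, 'b) ell1 \<Rightarrow> ('a, 'b) ell1" is "\<lambda>x g. - x g"
  by simp

lift_definition minus_ell1 :: "('a, 'b) ell1 \<Rightarrow> ('a, 'b) ell1 \<Rightarrow> ('a, 'b) ell1"
  is "\<lambda>x y g. x g - y g"
  subgoal for x y using abs_summable_on_plus[of x UNIV "\<lambda>g. - y g"] by simp
  done

lift_definition scaleR_ell1 :: "real \<Rightarrow> ('a, 'b) ell1 \<Rightarrow> ('a, 'b) ell1"
  is "\<lambda>r x g. r *\<^sub>R x g"
  by (simp add: summable_on_cmult_right)

lift_definition norm_ell1 :: "('a, 'b) ell1 \<Rightarrow> real" is "\<lambda>x. \<Sum>\<^sub>\<infinity>g. norm (x g)" .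

definition sgn_ell1 :: "('a, 'b) ell1 \<Rightarrow> ('a, 'b) ell1"
  where "sgn_ell1 x = inverse (norm x) *\<^sub>R x"

definition dist_ell1 :: "('a, 'b) ell1 \<Rightarrow> ('a, 'b) ell1 \<Rightarrow> real"
  where "dist_ell1 x y = norm (x - y)"

definition uniformity_ell1 :: "(('a, 'b) ell1 \<times> ('a, 'b) ell1) filter"
  where "uniformity_ell1 = (INF e\<in>{0<..}. principal {(x, y). dist x y < e})"

definition open_ell1 :: "('a, 'b) ell1 set \<Rightarrow> bool"
  where "open_ell1 S = (\<forall>x\<in>S. \<forall>\<^sub>F (x', y) in uniformity. x' = x \<longrightarrow> y \<in> S)"

instance
proof
  fix x y z :: "('a, 'b) ell1" and r s :: real
  show "x + y + z = x + (y + z)" by transfer (simp add: add.assoc)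
  show "x + y = y + x" by transfer (simp add: add.commute)
  show "0 + x = x" by transfer simp
  show "- x + x = 0" by transfer simp
  show "x - y = x + - y" by transfer simp
  show "r *\<^sub>R (x + y) = r *\<^sub>R x + r *\<^sub>R y" by transfer (simp add: scaleR_add_right)
  show "(r + s) *\<^sub>R x = r *\<^sub>R x + s *\<^sub>R x" by transfer (simp add: scaleR_add_left)
  show "r *\<^sub>R s *\<^sub>R x = (r * s) *\<^sub>R x" by transfer simp
  show "1 *\<^sub>R x = x" by transfer simp
  show "dist x y = norm (x - y)" by (rule dist_ell1_def)
  show "sgn x = inverse (norm x) *\<^sub>R x" by (rule sgn_ell1_def)
  show "uniformity = (INF e\<in>{0<..}. principal {(x :: ('a, 'b) ell1, y). dist x y < e})"
    by (rule uniformity_ell1_def)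
  show "open U = (\<forall>x\<in>U. \<forall>\<^sub>F (x', y) in uniformity. x' = x \<longrightarrow> y \<in> U)"
    for U :: "('a, 'b) ell1 set"
    by (rule open_ell1_def)
  show "norm x = 0 \<longleftrightarrow> x = 0"
  proof
    assume "norm x = 0"
    then have le: "(\<Sum>\<^sub>\<infinity>g. norm (ell1_coord x g)) \<le> 0"
      by (simp add: norm_ell1.rep_eq)
    have "norm (ell1_coord x g) = 0" for g
      by (rule nonneg_infsum_le_0D[OF le ell1_abs_summable]) auto
    then show "x = 0" by (intro ell1_eqI) (simp add: zero_ell1.rep_eq)
  qed (simp add: norm_ell1.rep_eq zero_ell1.rep_eq)
  show "norm (x + y) \<le> norm x + norm y"
  proof -
    have "norm (x + y) \<le> (\<Sum>\<^sub>\<infinity>g. norm (ell1_coord x g) + norm (ell1_coord y g))"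
      unfolding norm_ell1.rep_eq plus_ell1.rep_eq
      by (intro infsum_mono abs_summable_on_plus summable_on_add ell1_abs_summable norm_triangle_ineq)
    then show ?thesis
      by (simp add: norm_ell1.rep_eq infsum_add ell1_abs_summable)
  qed
  show "norm (r *\<^sub>R x) = \<bar>r\<bar> * norm x"
    by transfer (simp add: infsum_cmult_right')
qed

end

lift_definition ell1_scale :: "'k \<Rightarrow> ('g, 'k::real_normed_field) ell1 \<Rightarrow> ('g, 'k) ell1"
  is "\<lambda>c x g. c * x g"
  by (simp add: norm_mult summable_on_cmult_right)

interpretation ell1: vector_space "ell1_scale :: 'k::real_normed_field \<Rightarrow> ('g, 'k) ell1 \<Rightarrow> _"
  by unfold_locales (transfer, simp add: algebra_simps)+

lemma norm_ell1_scale: "norm (ell1_scale c x) = norm c * norm x"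
  by transfer (simp add: norm_mult infsum_cmult_right')

lemma ell1_scale_of_real: "ell1_scale (of_real r) x = r *\<^sub>R x"
  by transfer (simp add: scaleR_conv_of_real)

definition ell1_on :: "'g set \<Rightarrow> ('g, 'k::real_normed_field) ell1 set"
  where "ell1_on \<Gamma> = {x. \<forall>g. g \<notin> \<Gamma> \<longrightarrow> ell1_coord x g = 0}"

lemma subspace_ell1_on: "ell1.subspace (ell1_on \<Gamma>)"
  unfolding ell1.subspace_def ell1_on_def
  by (auto simp: zero_ell1.rep_eq plus_ell1.rep_eq ell1_scale.rep_eq)

lemma norm_ell1_on: "x \<in> ell1_on \<Gamma> \<Longrightarrow> norm x = (\<Sum>\<^sub>\<infinity>g\<in>\<Gamma>. norm (ell1_coord x g))"
  unfolding norm_ell1.rep_eq ell1_on_def by (intro infsum_cong_neutral) auto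

lift_definition ell1_basis :: "'g \<Rightarrow> ('g, 'k::real_normed_field) ell1"
  is "\<lambda>\<gamma> g. if g = \<gamma> then 1 else 0"
  subgoal for \<gamma>
    by (rule finite_nonzero_values_imp_summable_on) (rule finite_subset[of _ "{\<gamma>}"], auto)
  done

section \<open>Dense subspaces and isomorphisms\<close>

text \<open>
  In the following definitions \<open>s\<close>, \<open>s1\<close>, \<open>s2\<close> are scalar multiplications and the sets \<open>Y\<close>, \<open>Z\<close> are
  linear subspaces of the ambient normed spaces, regarded as normed spaces in the induced norm.
  A subspace of \<open>Y\<close> is dense in the relative topology of \<open>Y\<close> iff its ambient closure contains \<open>Y\<close>.
\<close>

definition dense_subspace_of ::
    "('k::real_normed_field \<Rightarrow> 'v \<Rightarrow> 'v) \<Rightarrow> 'v::real_normed_vector set \<Rightarrow> 'v set \<Rightarrow> bool"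
  where "dense_subspace_of s Y0 Y \<longleftrightarrow> module.subspace s Y0 \<and> Y0 \<subseteq> Y \<and> Y \<subseteq> closure Y0"

definition linearly_isomorphic ::
    "('k::real_normed_field \<Rightarrow> 'v \<Rightarrow> 'v) \<Rightarrow> 'v::real_normed_vector set \<Rightarrow>
     ('k \<Rightarrow> 'w \<Rightarrow> 'w) \<Rightarrow> 'w::real_normed_vector set \<Rightarrow> bool"
  where "linearly_isomorphic s1 Y s2 Z \<longleftrightarrow>
    (\<exists>T. bij_betw T Y Z \<and>
      (\<forall>x\<in>Y. \<forall>y\<in>Y. T (x + y) = T x + T y) \<and>
      (\<forall>c. \<forall>x\<in>Y. T (s1 c x) = s2 c (T x)) \<and>
      (\<exists>B. \<forall>x\<in>Y. norm (T x) \<le> B * norm x) \<and>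
      (\<exists>B. \<forall>z\<in>Z. norm (inv_into Y T z) \<le> B * norm z))"

definition densely_isomorphic ::
    "('k::real_normed_field \<Rightarrow> 'v \<Rightarrow> 'v) \<Rightarrow> 'v::real_normed_vector set \<Rightarrow>
     ('k \<Rightarrow> 'w \<Rightarrow> 'w) \<Rightarrow> 'w::real_normed_vector set \<Rightarrow> bool"
  where "densely_isomorphic s1 Y s2 Z \<longleftrightarrow>
    (\<exists>Y0 Z0. dense_subspace_of s1 Y0 Y \<and> dense_subspace_of s2 Z0 Z \<and>
      linearly_isomorphic s1 Y0 s2 Z0)"

end

theory Submission
  imports Defs
begin

text \<open>
  Perturb the basis: choose \<open>y \<gamma>\<close> in the given dense subspace within \<open>1/2\<close> of \<open>e \<gamma>\<close>. By the \<open>\<ell>\<^sub>1\<close>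
  norm, the linear map \<open>T\<close> on \<open>span {e \<gamma>}\<close> with \<open>T (e \<gamma>) = y \<gamma>\<close> satisfies
  \<open>norm (T x - x) \<le> norm x / 2\<close>, so it is an isomorphism onto its range. The range is dense
  because every \<open>x\<close> is within \<open>3/4 * norm x\<close> of it, and this estimate can be iterated on the
  remainder; completeness of the scalar field is thus not used.
\<close>

section \<open>Linear isomorphisms between subspaces: explicit inverses, symmetry,
  transitivity\<close>

text \<open>An explicit two-sided inverse \<open>S\<close> agrees with \<open>inv_into Y T\<close>
  on \<open>Z\<close>, so the bound demanded of the latter can be checked on
  \<open>S\<close>.\<close>

lemma linearly_isomorphicI:
  assumes T: "\<And>x. x \<in> Y \<Longrightarrow> T x \<in> Z" and S: "\<And>z. z \<in> Z \<Longrightarrow> S z \<in> Y"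
    and ST: "\<And>x. x \<in> Y \<Longrightarrow> S (T x) = x" and TS: "\<And>z. z \<in> Z \<Longrightarrow> T (S z) = z"
    and "\<And>x y. x \<in> Y \<Longrightarrow> y \<in> Y \<Longrightarrow> T (x + y) = T x + T y"
    and "\<And>c x. x \<in> Y \<Longrightarrow> T (s1 c x) = s2 c (T x)"
    and "\<And>x. x \<in> Y \<Longrightarrow> norm (T x) \<le> A * norm x"
    and S_bound: "\<And>z. z \<in> Z \<Longrightarrow> norm (S z) \<le> B * norm z"
  shows "linearly_isomorphic s1 Y s2 Z"
proof -
  have bij: "bij_betw T Y Z"
    by (rule bij_betwI[of _ _ _ S]) (use T S ST TS in auto)
  have "inv_into Y T z = S z" if "z \<in> Z" for z
    using that S TS bij by (metis bij_betw_inv_into_left)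
  then show ?thesis
    unfolding linearly_isomorphic_def using assms bij
    by (intro exI[of _ T] conjI exI[of _ A] exI[of _ B]) auto
qed

text \<open>Passing to absolute values makes both constants nonnegative, which is what lets bounds
  be multiplied when isomorphisms are composed.\<close>

lemma linearly_isomorphicE:
  assumes "linearly_isomorphic s1 Y s2 Z"
  obtains T S A B where "0 \<le> A" "0 \<le> B"
    "\<forall>x\<in>Y. T x \<in> Z" "\<forall>z\<in>Z. S z \<in> Y" "\<forall>x\<in>Y. S (T x) = x" "\<forall>z\<in>Z. T (S z) = z"
    "\<forall>x\<in>Y. \<forall>y\<in>Y. T (x + y) = T x + T y" "\<forall>c. \<forall>x\<in>Y. T (s1 c x) = s2 c (T x)"
    "\<forall>x\<in>Y. norm (T x) \<le> A * norm x" "\<forall>z\<in>Z. norm (S z) \<le> B * norm z"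
proof -
  from assms obtain T A B where T: "bij_betw T Y Z"
      "\<forall>x\<in>Y. \<forall>y\<in>Y. T (x + y) = T x + T y" "\<forall>c. \<forall>x\<in>Y. T (s1 c x) = s2 c (T x)"
    and A: "\<forall>x\<in>Y. norm (T x) \<le> A * norm x"
    and B: "\<forall>z\<in>Z. norm (inv_into Y T z) \<le> B * norm z"
    unfolding linearly_isomorphic_def by blast
  have abs: "C * norm v \<le> \<bar>C\<bar> * norm v" for C and v :: "'x::real_normed_vector"
    by (intro mult_right_mono) auto
  show ?thesis
  proof (rule that[of "\<bar>A\<bar>" "\<bar>B\<bar>" T "inv_into Y T"])
    show "\<forall>x\<in>Y. norm (T x) \<le> \<bar>A\<bar> * norm x"
      using A abs by (blast intro: order_trans)
    show "\<forall>z\<in>Z. norm (inv_into Y T z) \<le> \<bar>B\<bar> * norm z"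
      using B abs by (blast intro: order_trans)
    show "\<forall>z\<in>Z. inv_into Y T z \<in> Y"
      using T(1) by (metis bij_betw_def inv_into_into)
  qed (use T in \<open>auto simp: bij_betwE bij_betw_inv_into_left bij_betw_inv_into_right\<close>)
qed

text \<open>Since \<open>Y\<close> is closed under the operations, \<open>S x + S y\<close> and
  \<open>s1 c (S x)\<close> lie where \<open>S\<close> undoes \<open>T\<close>; applying
  \<open>T\<close> and then \<open>S\<close> to them transfers linearity from \<open>T\<close> to
  \<open>S\<close>.\<close>

lemma linearly_isomorphic_sym:
  assumes "module s1" "module.subspace s1 Y" "linearly_isomorphic s1 Y s2 Z"
  shows "linearly_isomorphic s2 Z s1 Y"
proof -
  from assms(3) obtain T S A B where
    T: "\<forall>x\<in>Y. T x \<in> Z" and S: "\<forall>z\<in>Z. S z \<in> Y"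
    and ST: "\<forall>x\<in>Y. S (T x) = x" and TS: "\<forall>z\<in>Z. T (S z) = z"
    and add: "\<forall>x\<in>Y. \<forall>y\<in>Y. T (x + y) = T x + T y"
    and scale: "\<forall>c. \<forall>x\<in>Y. T (s1 c x) = s2 c (T x)"
    and A: "\<forall>x\<in>Y. norm (T x) \<le> A * norm x"
    and B: "\<forall>z\<in>Z. norm (S z) \<le> B * norm z"
    by (elim linearly_isomorphicE)
  show ?thesis
  proof (rule linearly_isomorphicI[of Z S Y T])
    show "S (x + y) = S x + S y" if "x \<in> Z" "y \<in> Z" for x y
    proof -
      have "S x + S y \<in> Y"
        using that S assms(1,2) by (simp add: module.subspace_add)
      then have "S (T (S x + S y)) = S x + S y" using ST by blast
      then show ?thesis using that S add TS by simp
    qed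
    show "S (s2 c x) = s1 c (S x)" if "x \<in> Z" for c x
    proof -
      have "s1 c (S x) \<in> Y"
        using that S assms(1,2) by (simp add: module.subspace_scale)
      then have "S (T (s1 c (S x))) = s1 c (S x)" using ST by blast
      then show ?thesis using that S scale TS by simp
    qed
  qed (use T S ST TS A B in auto)
qed

lemma linearly_isomorphic_trans:
  assumes "linearly_isomorphic s1 X s2 Y" "linearly_isomorphic s2 Y s3 Z"
  shows "linearly_isomorphic s1 X s3 Z"
proof -
  from assms(1) obtain T S A B where "0 \<le> A" "0 \<le> B"
    and T: "\<forall>x\<in>X. T x \<in> Y" "\<forall>z\<in>Y. S z \<in> X" "\<forall>x\<in>X. S (T x) = x" "\<forall>z\<in>Y. T (S z) = z"
      "\<forall>x\<in>X. \<forall>y\<in>X. T (x + y) = T x + T y" "\<forall>c. \<forall>x\<in>X. T (s1 c x) = s2 c (T x)"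
    and A: "\<forall>x\<in>X. norm (T x) \<le> A * norm x"
    and B: "\<forall>z\<in>Y. norm (S z) \<le> B * norm z"
    by (elim linearly_isomorphicE)
  from assms(2) obtain T' S' A' B' where "0 \<le> A'" "0 \<le> B'"
    and T': "\<forall>x\<in>Y. T' x \<in> Z" "\<forall>z\<in>Z. S' z \<in> Y" "\<forall>x\<in>Y. S' (T' x) = x" "\<forall>z\<in>Z. T' (S' z) = z"
      "\<forall>x\<in>Y. \<forall>y\<in>Y. T' (x + y) = T' x + T' y" "\<forall>c. \<forall>x\<in>Y. T' (s2 c x) = s3 c (T' x)"
    and A': "\<forall>x\<in>Y. norm (T' x) \<le> A' * norm x"
    and B': "\<forall>z\<in>Z. norm (S' z) \<le> B' * norm z"
    by (elim linearly_isomorphicE)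
  show ?thesis
  proof (rule linearly_isomorphicI[of X "\<lambda>x. T' (T x)" Z "\<lambda>z. S (S' z)"])
    show "norm (T' (T x)) \<le> (A' * A) * norm x" if "x \<in> X" for x
    proof -
      have "norm (T' (T x)) \<le> A' * norm (T x)" using that T(1) A' by blast
      also have "\<dots> \<le> A' * (A * norm x)" using that A \<open>0 \<le> A'\<close> by (simp add: mult_left_mono)
      finally show ?thesis by (simp add: mult.assoc)
    qed
    show "norm (S (S' z)) \<le> (B * B') * norm z" if "z \<in> Z" for z
    proof -
      have "norm (S (S' z)) \<le> B * norm (S' z)" using that T'(2) B by blast
      also have "\<dots> \<le> B * (B' * norm z)" using that B' \<open>0 \<le> B\<close> by (simp add: mult_left_mono)
      finally show ?thesis by (simp add: mult.assoc)
    qed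
  qed (use T T' in auto)
qed

section \<open>Finitely supported families and linear maps prescribed on the basis\<close>

definition ell1_finsupp :: "'g set \<Rightarrow> ('g, 'k::real_normed_field) ell1 set"
  where "ell1_finsupp \<Gamma> = {x \<in> ell1_on \<Gamma>. finite {g. ell1_coord x g \<noteq> 0}}"

text \<open>On finitely supported \<open>x\<close> this is the linear map with
  \<open>ell1_basis g\<close> sent to \<open>y g\<close>. For infinite support the sum takes the
  default value 0, so linearity is claimed for finite supports.\<close>

definition ell1_comb :: "('g \<Rightarrow> ('h, 'k) ell1) \<Rightarrow> ('g, 'k::real_normed_field) ell1 \<Rightarrow> ('h, 'k) ell1"
  where "ell1_comb y x = (\<Sum>g | ell1_coord x g \<noteq> 0. ell1_scale (ell1_coord x g) (y g))"

text \<open>The index set of the defining sum varies with \<open>x\<close>; a common finite superset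
  allows sums for different arguments to be compared termwise.\<close>

lemma ell1_comb_eq_sum:
  assumes "finite F" "{g. ell1_coord x g \<noteq> 0} \<subseteq> F"
  shows "ell1_comb y x = (\<Sum>g\<in>F. ell1_scale (ell1_coord x g) (y g))"
  unfolding ell1_comb_def by (rule sum.mono_neutral_left) (use assms in auto)

lemma ell1_coord_sum: "ell1_coord (\<Sum>i\<in>F. x i) g = (\<Sum>i\<in>F. ell1_coord (x i) g)"
  by (induction F rule: infinite_finite_induct) (auto simp: zero_ell1.rep_eq plus_ell1.rep_eq)

lemma ell1_coord_sum_basis:
  assumes "finite F"
  shows "ell1_coord (\<Sum>i\<in>F. ell1_scale (c i) (ell1_basis i)) g = (if g \<in> F then c g else 0)"
  using assms by (simp add: ell1_coord_sum ell1_scale.rep_eq ell1_basis.rep_eq if_distrib cong: if_cong)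

lemma ell1_basis_in_ell1_on: "g \<in> \<Gamma> \<Longrightarrow> ell1_basis g \<in> ell1_on \<Gamma>"
  by (auto simp: ell1_on_def ell1_basis.rep_eq)

lemma ell1_comb_basis:
  assumes "finite {g. ell1_coord x g \<noteq> 0}"
  shows "ell1_comb ell1_basis x = x"
  unfolding ell1_comb_def by (rule ell1_eqI) (use assms in \<open>auto simp: ell1_coord_sum_basis\<close>)

lemma subspace_ell1_finsupp:
  "ell1.subspace (ell1_finsupp \<Gamma> :: ('g, 'k::real_normed_field) ell1 set)"
proof -
  have "finite {g. ell1_coord (x + y) g \<noteq> 0}"
    if "finite {g. ell1_coord x g \<noteq> 0}" "finite {g. ell1_coord y g \<noteq> 0}" for x y :: "('g, 'k) ell1"
    by (rule finite_subset[OF _ finite_UnI[OF that]]) (auto simp: plus_ell1.rep_eq)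
  moreover have "finite {g. ell1_coord (ell1_scale c x) g \<noteq> 0}"
    if "finite {g. ell1_coord x g \<noteq> 0}" for c and x :: "('g, 'k) ell1"
    by (rule finite_subset[OF _ that]) (auto simp: ell1_scale.rep_eq)
  ultimately show ?thesis
    using subspace_ell1_on[of \<Gamma>] unfolding ell1.subspace_def ell1_finsupp_def
    by (auto simp: zero_ell1.rep_eq)
qed

text \<open>Coordinates vanish off \<open>\<Gamma>\<close>, so every \<open>y g\<close> that occurs
  lies in \<open>V\<close>. An infinite support is harmless, as the sum is then 0.\<close>

lemma ell1_comb_in_subspace:
  assumes "ell1.subspace V" "\<And>g. g \<in> \<Gamma> \<Longrightarrow> y g \<in> V" "x \<in> ell1_on \<Gamma>"
  shows "ell1_comb y x \<in> V"
  unfolding ell1_comb_def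
  by (intro ell1.subspace_sum ell1.subspace_scale) (use assms in \<open>auto simp: ell1_on_def\<close>)

text \<open>The inclusion from right to left is the expansion
  \<open>ell1_comb ell1_basis x = x\<close>. The coordinate description of the span is what the
  perturbation argument works with.\<close>

lemma span_ell1_basis:
  "ell1.span (ell1_basis ` \<Gamma>) = (ell1_finsupp \<Gamma> :: ('g, 'k::real_normed_field) ell1 set)"
  (is "?S = ?E")
proof
  show "?S \<subseteq> ?E"
    by (rule ell1.span_minimal[OF _ subspace_ell1_finsupp])
      (auto simp: ell1_finsupp_def ell1_basis_in_ell1_on ell1_basis.rep_eq)
  show "?E \<subseteq> ?S"
  proof
    fix x assume "x \<in> ?E"
    then have "x \<in> ell1_on \<Gamma>" "ell1_comb ell1_basis x = x"
      by (auto simp: ell1_finsupp_def ell1_comb_basis)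
    moreover have "ell1_comb ell1_basis x \<in> ?S"
      by (rule ell1_comb_in_subspace[OF ell1.subspace_span _ \<open>x \<in> ell1_on \<Gamma>\<close>])
        (simp add: ell1.span_base)
    ultimately show "x \<in> ?S" by simp
  qed
qed

lemma norm_ell1_finite:
  assumes "finite F" "{g. ell1_coord x g \<noteq> 0} \<subseteq> F"
  shows "norm x = (\<Sum>g\<in>F. norm (ell1_coord x g))"
proof -
  have "norm x = (\<Sum>\<^sub>\<infinity>g\<in>F. norm (ell1_coord x g))"
    unfolding norm_ell1.rep_eq by (rule infsum_cong_neutral) (use assms in auto)
  with assms show ?thesis by simp
qed

lemma ell1_comb_add:
  assumes "finite {g. ell1_coord x g \<noteq> 0}" "finite {g. ell1_coord z g \<noteq> 0}"
  shows "ell1_comb y (x + z) = ell1_comb y x + ell1_comb y z"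
proof -
  let ?F = "{g. ell1_coord x g \<noteq> 0} \<union> {g. ell1_coord z g \<noteq> 0}"
  have F: "finite ?F" using assms by simp
  have "{g. ell1_coord (x + z) g \<noteq> 0} \<subseteq> ?F" by (auto simp: plus_ell1.rep_eq)
  then show ?thesis
    by (simp add: ell1_comb_eq_sum[OF F] plus_ell1.rep_eq ell1.scale_left_distrib sum.distrib)
qed

lemma ell1_comb_scale:
  assumes "finite {g. ell1_coord x g \<noteq> 0}"
  shows "ell1_comb y (ell1_scale c x) = ell1_scale c (ell1_comb y x)"
proof -
  have "{g. ell1_coord (ell1_scale c x) g \<noteq> 0} \<subseteq> {g. ell1_coord x g \<noteq> 0}"
    by (auto simp: ell1_scale.rep_eq)
  then show ?thesis
    by (simp add: ell1_comb_eq_sum[OF assms] ell1_scale.rep_eq ell1.scale_sum_right)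
qed

section \<open>Perturbation of the basis and finite truncation\<close>

text \<open>Expanding \<open>x\<close> in the basis turns the difference into a combination of the
  errors \<open>y g - ell1_basis g\<close> with the coordinates of \<open>x\<close> as coefficients.
  The absolute values of these coefficients add up to exactly \<open>norm x\<close>, so a uniform
  error bound suffices.\<close>

lemma norm_ell1_comb_diff_le:
  assumes y: "\<And>g. g \<in> \<Gamma> \<Longrightarrow> norm (y g - ell1_basis g) \<le> \<epsilon>" and x: "x \<in> ell1_finsupp \<Gamma>"
  shows "norm (ell1_comb y x - x) \<le> \<epsilon> * norm x"
proof -
  let ?F = "{g. ell1_coord x g \<noteq> 0}"
  have F: "finite ?F" "?F \<subseteq> \<Gamma>"
    using x by (auto simp: ell1_finsupp_def ell1_on_def)
  have "ell1_comb y x - x = ell1_comb y x - ell1_comb ell1_basis x"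
    using F by (simp add: ell1_comb_basis)
  also have "\<dots> = (\<Sum>g\<in>?F. ell1_scale (ell1_coord x g) (y g - ell1_basis g))"
    by (simp add: ell1_comb_def ell1.scale_right_diff_distrib sum_subtractf)
  also have "norm \<dots> \<le> (\<Sum>g\<in>?F. norm (ell1_coord x g) * \<epsilon>)"
    by (rule sum_norm_le) (use y F in \<open>auto simp: norm_ell1_scale intro!: mult_left_mono\<close>)
  also have "\<dots> = \<epsilon> * norm x"
    by (simp add: norm_ell1_finite[OF F(1)] sum_distrib_left mult.commute)
  finally show ?thesis .
qed

text \<open>Truncate \<open>x\<close> to a finite set \<open>F\<close> carrying all but
  \<open>\<delta>\<close> of its norm; the norm splits additively into the truncation and the
  tail.\<close>

lemma ell1_finsupp_approx:
  assumes x: "x \<in> ell1_on \<Gamma>" and "\<delta> > 0"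
  obtains z where "z \<in> ell1_finsupp \<Gamma>" "norm (x - z) \<le> \<delta>" "norm z \<le> norm x"
proof -
  let ?f = "\<lambda>g. norm (ell1_coord x g)"
  obtain F where F: "finite F" "dist (sum ?f F) (norm x) \<le> \<delta>"
    using infsum_finite_approximation[OF ell1_abs_summable[of x] \<open>\<delta> > 0\<close>]
    unfolding norm_ell1.rep_eq by auto
  define z where "z = (\<Sum>g\<in>F. ell1_scale (ell1_coord x g) (ell1_basis g))"
  have z: "ell1_coord z g = (if g \<in> F then ell1_coord x g else 0)" for g
    using F by (simp add: z_def ell1_coord_sum_basis)
  have "finite {g. ell1_coord z g \<noteq> 0}"
    by (rule finite_subset[OF _ F(1)]) (auto simp: z)
  with x have "z \<in> ell1_finsupp \<Gamma>"
    by (auto simp: ell1_finsupp_def ell1_on_def z)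
  have "norm (x - z) = infsum ?f (UNIV - F)"
    unfolding norm_ell1.rep_eq by (rule infsum_cong_neutral) (auto simp: minus_ell1.rep_eq z)
  also have "\<dots> = norm x - sum ?f F"
    using F by (subst infsum_Diff) (auto simp: ell1_abs_summable norm_ell1.rep_eq)
  finally have diff: "norm (x - z) = norm x - sum ?f F" .
  have "norm z = sum ?f F"
    using F by (subst norm_ell1_finite[of F]) (auto simp: z)
  with diff norm_ge_zero[of "x - z"] have "norm z \<le> norm x" by linarith
  moreover have "norm (x - z) \<le> \<delta>"
    using F(2) diff by (simp add: dist_real_def)
  ultimately show ?thesis
    using that \<open>z \<in> ell1_finsupp \<Gamma>\<close> by blast
qed

text \<open>An iterated almost-best approximation replaces the Neumann series.\<close>

lemma subset_closure_if_contracting_approx: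
  fixes V W :: "'v::real_normed_vector set"
  assumes V_diff: "\<And>x w. x \<in> V \<Longrightarrow> w \<in> W \<Longrightarrow> x - w \<in> V"
    and W: "0 \<in> W" "\<And>v w. v \<in> W \<Longrightarrow> w \<in> W \<Longrightarrow> v + w \<in> W"
    and "0 \<le> q" "q < 1"
    and approx: "\<And>x. x \<in> V \<Longrightarrow> \<exists>w\<in>W. norm (x - w) \<le> q * norm x"
  shows "V \<subseteq> closure W"
proof
  fix x assume x: "x \<in> V"
  have iter: "\<exists>w\<in>W. norm (x - w) \<le> q ^ n * norm x" for n
  proof (induction n)
    case 0
    then show ?case using W(1) by (intro bexI[of _ 0]) auto
  next
    case (Suc n)
    then obtain w where w: "w \<in> W" "norm (x - w) \<le> q ^ n * norm x" by blast
    \<comment> \<open>The remainder \<open>x - w\<close> is again in \<open>V\<close>, so it can be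
      approximated in turn; the correction \<open>v\<close> is added to \<open>w\<close>.\<close>
    obtain v where v: "v \<in> W" "norm (x - w - v) \<le> q * norm (x - w)"
      using approx[OF V_diff[OF x w(1)]] by blast
    have "norm (x - (w + v)) \<le> q ^ Suc n * norm x"
      using v(2) mult_left_mono[OF w(2) \<open>0 \<le> q\<close>] by (simp add: diff_diff_eq mult.assoc)
    then show ?case using W(2)[OF w(1) v(1)] by blast
  qed
  show "x \<in> closure W"
    unfolding closure_approachable
  proof (intro allI impI)
    fix e :: real assume "e > 0"
    have "(\<lambda>n. q ^ n * norm x) \<longlonglongrightarrow> 0 * norm x"
      by (intro tendsto_mult_right LIMSEQ_power_zero) (use \<open>0 \<le> q\<close> \<open>q < 1\<close> in auto)
    with \<open>e > 0\<close> have "eventually (\<lambda>n. q ^ n * norm x < e) sequentially"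
      by (intro order_tendstoD(2)) auto
    then obtain n where "q ^ n * norm x < e"
      by (meson eventually_happens trivial_limit_sequentially)
    moreover obtain w where "w \<in> W" "norm (x - w) \<le> q ^ n * norm x"
      using iter by blast
    ultimately show "\<exists>w\<in>W. dist w x < e"
      by (intro bexI[of _ w]) (auto simp: dist_norm norm_minus_commute)
  qed
qed

section \<open>The copy of the span inside a dense subspace\<close>

lemma dense_subspace_contains_copy_of_span:
  fixes \<Gamma> :: "'g set" and Y :: "('g, 'k::real_normed_field) ell1 set"
  assumes "dense_subspace_of ell1_scale Y (ell1_on \<Gamma>)"
  obtains Y0 where "dense_subspace_of ell1_scale Y0 Y"
    "linearly_isomorphic ell1_scale Y0 ell1_scale (ell1.span (ell1_basis ` \<Gamma> :: ('g, 'k) ell1 set))"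
proof -
  have Y: "ell1.subspace Y" "Y \<subseteq> ell1_on \<Gamma>" "ell1_on \<Gamma> \<subseteq> closure Y"
    using assms by (auto simp: dense_subspace_of_def)
  have "\<exists>v. v \<in> Y \<and> norm (v - ell1_basis g) \<le> 1/2" if "g \<in> \<Gamma>" for g
    using ell1_basis_in_ell1_on[OF that] Y(3) closure_approachable[of "ell1_basis g" Y]
    by (force simp: dist_norm dest: spec[of _ "1/2"])
  then obtain y where y: "\<And>g. g \<in> \<Gamma> \<Longrightarrow> y g \<in> Y"
      "\<And>g. g \<in> \<Gamma> \<Longrightarrow> norm (y g - ell1_basis g) \<le> 1/2"
    by metis
  let ?E = "ell1_finsupp \<Gamma> :: ('g, 'k) ell1 set"
  let ?T = "ell1_comb y"
  define Y0 where "Y0 = ?T ` ?E"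
  have T_near: "norm (?T x - x) \<le> 1/2 * norm x" if "x \<in> ?E" for x
    using norm_ell1_comb_diff_le[OF y(2) that] .
  have T_upper: "norm (?T x) \<le> 2 * norm x" if "x \<in> ?E" for x
    using T_near[OF that] norm_triangle_ineq2[of "?T x" x] norm_ge_zero[of x] by linarith
  \<comment> \<open>By the reverse triangle inequality \<open>?T\<close> loses at most half the
    norm; this gives both injectivity and the bound on the inverse.\<close>
  have T_lower: "norm x \<le> 2 * norm (?T x)" if "x \<in> ?E" for x
    using T_near[OF that] norm_triangle_ineq2[of x "?T x"] by (simp add: norm_minus_commute)
  have T_add: "?T (x + z) = ?T x + ?T z" if "x \<in> ?E" "z \<in> ?E" for x z
    using that by (intro ell1_comb_add) (auto simp: ell1_finsupp_def)
  have T_scale: "?T (ell1_scale c x) = ell1_scale c (?T x)" if "x \<in> ?E" for c x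
    using that by (intro ell1_comb_scale) (auto simp: ell1_finsupp_def)
  have E: "ell1.subspace ?E" by (rule subspace_ell1_finsupp)
  have T_0: "?T 0 = 0"
    by (simp add: ell1_comb_def zero_ell1.rep_eq)
  have inj: "inj_on ?T ?E"
  proof (rule inj_onI)
    fix x z assume xz: "x \<in> ?E" "z \<in> ?E" "?T x = ?T z"
    have d: "x - z \<in> ?E" using E xz by (simp add: ell1.subspace_diff)
    have "?T (x - z) + ?T z = ?T z"
      using T_add[OF d xz(2)] xz(3) by simp
    with T_lower[OF d] show "x = z" by simp
  qed
  have Y0: "ell1.subspace Y0"
    unfolding ell1.subspace_def Y0_def
  proof (intro conjI ballI allI)
    show "0 \<in> ?T ` ?E"
      using T_0[symmetric] ell1.subspace_0[OF E] by (rule image_eqI)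
    show "v + w \<in> ?T ` ?E" if "v \<in> ?T ` ?E" "w \<in> ?T ` ?E" for v w
      using that by (auto simp flip: T_add intro!: imageI ell1.subspace_add[OF E])
    show "ell1_scale c v \<in> ?T ` ?E" if "v \<in> ?T ` ?E" for c v
      using that by (auto simp flip: T_scale intro!: imageI ell1.subspace_scale[OF E])
  qed
  have sub: "Y0 \<subseteq> Y"
    using ell1_comb_in_subspace[OF Y(1) y(1)] by (auto simp: Y0_def ell1_finsupp_def)
  have dense: "ell1_on \<Gamma> \<subseteq> closure Y0"
  \<comment> \<open>The factor 3/4 is 1/4 for truncating \<open>x\<close> to a finite support plus
    1/2 for replacing the truncation \<open>z\<close> by \<open>?T z\<close>.\<close>
  proof (rule subset_closure_if_contracting_approx[where q = "3/4"])
    show "x - w \<in> ell1_on \<Gamma>" if "x \<in> ell1_on \<Gamma>" "w \<in> Y0" for x w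
      using that sub Y(2) subspace_ell1_on by (blast intro: ell1.subspace_diff)
    show "\<exists>w\<in>Y0. norm (x - w) \<le> 3/4 * norm x" if x: "x \<in> ell1_on \<Gamma>" for x
    \<comment> \<open>The truncation error \<open>1/4 * norm x\<close> must be positive, so 0 is
      treated separately.\<close>
    proof (cases "x = 0")
      case True
      then show ?thesis using ell1.subspace_0[OF Y0] by auto
    next
      case False
      then have "1/4 * norm x > 0" by simp
      from ell1_finsupp_approx[OF x this] obtain z
        where z: "z \<in> ?E" "norm (x - z) \<le> 1/4 * norm x" "norm z \<le> norm x" by blast
      have "norm (x - ?T z) \<le> norm (x - z) + norm (z - ?T z)"
        using norm_triangle_ineq[of "x - z" "z - ?T z"] by simp
      then have "norm (x - ?T z) \<le> 3/4 * norm x"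
        using z T_near[OF z(1)] by (simp add: norm_minus_commute)
      then show ?thesis using z(1) by (auto simp: Y0_def)
    qed
  qed (use Y0 in \<open>auto intro: ell1.subspace_0 ell1.subspace_add\<close>)
  have "linearly_isomorphic ell1_scale ?E ell1_scale Y0"
  proof (rule linearly_isomorphicI[of ?E ?T Y0 "inv_into ?E ?T"])
    show "norm (inv_into ?E ?T z) \<le> 2 * norm z" if "z \<in> Y0" for z
      using that inj T_lower by (auto simp: Y0_def)
  qed (use inj T_upper T_add T_scale in \<open>auto simp: Y0_def\<close>)
  then have "linearly_isomorphic ell1_scale Y0 ell1_scale ?E"
    by (rule linearly_isomorphic_sym[OF ell1.module_axioms E])
  moreover have "dense_subspace_of ell1_scale Y0 Y"
    \<comment> \<open>Density in \<open>Y\<close> follows from density in the larger set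
      \<open>ell1_on \<Gamma>\<close>.\<close>
    using Y0 sub dense Y(2) by (auto simp: dense_subspace_of_def)
  ultimately show ?thesis
    using that by (simp add: span_ell1_basis)
qed

theorem theorem2p4:
  fixes \<Gamma> :: "'g set"
  shows "(\<forall>Y :: ('g, 'k::real_normed_field) ell1 set.
            dense_subspace_of ell1_scale Y (ell1_on \<Gamma>) \<longrightarrow>
            (\<exists>Y0. dense_subspace_of ell1_scale Y0 Y \<and>
              linearly_isomorphic ell1_scale Y0 ell1_scale
                (ell1.span (ell1_basis ` \<Gamma> :: ('g, 'k) ell1 set)))) \<and>
         (\<forall>Y Z :: ('g, 'k) ell1 set.
            dense_subspace_of ell1_scale Y (ell1_on \<Gamma>) \<longrightarrow>
            dense_subspace_of ell1_scale Z (ell1_on \<Gamma>) \<longrightarrow>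
            densely_isomorphic ell1_scale Y ell1_scale Z)"
proof (intro conjI allI impI)
  let ?E = "ell1.span (ell1_basis ` \<Gamma> :: ('g, 'k) ell1 set)"
  show copy: "\<exists>Y0. dense_subspace_of ell1_scale Y0 Y \<and> linearly_isomorphic ell1_scale Y0 ell1_scale ?E"
    if "dense_subspace_of ell1_scale Y (ell1_on \<Gamma>)" for Y :: "('g, 'k) ell1 set"
    using dense_subspace_contains_copy_of_span[OF that] by metis
  fix Y Z :: "('g, 'k) ell1 set"
  assume "dense_subspace_of ell1_scale Y (ell1_on \<Gamma>)" "dense_subspace_of ell1_scale Z (ell1_on \<Gamma>)"
  then obtain Y0 Z0 where Y0: "dense_subspace_of ell1_scale Y0 Y"
      "linearly_isomorphic ell1_scale Y0 ell1_scale ?E"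
    and Z0: "dense_subspace_of ell1_scale Z0 Z" "linearly_isomorphic ell1_scale Z0 ell1_scale ?E"
    using copy by metis
  \<comment> \<open>The span is the common model: \<open>Y0\<close> is isomorphic to
    \<open>?E\<close>, and \<open>?E\<close> to \<open>Z0\<close>.\<close>
  have "linearly_isomorphic ell1_scale ?E ell1_scale Z0"
    using linearly_isomorphic_sym[OF ell1.module_axioms _ Z0(2)] Z0(1)
    by (simp add: dense_subspace_of_def)
  with Y0(2) have "linearly_isomorphic ell1_scale Y0 ell1_scale Z0"
    by (rule linearly_isomorphic_trans)
  with Y0 Z0 show "densely_isomorphic ell1_scale Y ell1_scale Z"
    unfolding densely_isomorphic_def by blast
qed

end
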